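(* If $f\in \mathcal{C}^{\infty}(\mathbb{R}^n)$ is g-convex with respect to some connection on $\mathbb{R}^n$, then the Euclidean Hessian matrix $\left(\frac{\partial^2 f}{\partial x_i\partial x_j}\right)_{i,j=1}^n$ is positive semidefinite at every critical point of $f$.
   Context: A connection means a smooth torsion-free affine connection $\nabla$ ($\nabla_XY-\nabla_YX=[X,Y]$). A smooth function $f$ on a manifold $\mathcal{M}$ is g-convex with respect to $\nabla$ if $f\circ\gamma:[0,1]\to\mathbb{R}$ is convex for every $\nabla$-geodesic $\gamma:[0,1]\to\mathcal{M}$; equivalently, $\mathrm{Hess}_\nabla f(X,Y)=X(Y(f))-(\nabla_XY)(f)$ is positive semidefinite at every point. *)

theory Defs
  imports "HOL-Analysis.Analysis"
begin

primrec Ck :: "nat \<Rightarrow> ('a::euclidean_space \<Rightarrow> 'b::real_normed_vector) \<Rightarrow> bool" where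
  "Ck 0 f \<longleftrightarrow> continuous_on UNIV f"
| "Ck (Suc k) f \<longleftrightarrow>
     (\<forall>x. f differentiable (at x)) \<and> (\<forall>v. Ck k (\<lambda>x. frechet_derivative f (at x) v))"

definition smooth :: "('a::euclidean_space \<Rightarrow> 'b::real_normed_vector) \<Rightarrow> bool" where
  "smooth f \<longleftrightarrow> (\<forall>k. Ck k f)"

text \<open>Vector fields on Euclidean space are maps from the space to itself. The derivative of a
  function along a vector field acts componentwise on vector-valued functions.\<close>

definition dir_deriv ::
  "('a::euclidean_space \<Rightarrow> 'a) \<Rightarrow> ('a \<Rightarrow> 'b::real_normed_vector) \<Rightarrow> 'a \<Rightarrow> 'b" where
  "dir_deriv X g x = frechet_derivative g (at x) (X x)"

text \<open>In the global coordinates, the bracket defined by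
  \<open>[X,Y](g) = X(Y(g)) - Y(X(g))\<close> has the components \<open>X(Y\<^sub>i) - Y(X\<^sub>i)\<close>.\<close>

definition lie_bracket ::
  "('a::euclidean_space \<Rightarrow> 'a) \<Rightarrow> ('a \<Rightarrow> 'a) \<Rightarrow> 'a \<Rightarrow> 'a" where
  "lie_bracket X Y x = dir_deriv X Y x - dir_deriv Y X x"

text \<open>A connection is an operator on smooth vector fields; its values on other maps are
  unconstrained. Real linearity in the second argument is the Leibniz rule for constant \<open>g\<close>
  together with additivity.\<close>

definition torsion_free_connection ::
  "((real^'n \<Rightarrow> real^'n) \<Rightarrow> (real^'n \<Rightarrow> real^'n) \<Rightarrow> (real^'n \<Rightarrow> real^'n)) \<Rightarrow> bool" where
  "torsion_free_connection nabla \<longleftrightarrow>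
     (\<forall>X Y. smooth X \<longrightarrow> smooth Y \<longrightarrow> smooth (nabla X Y)) \<and>
     (\<forall>X X' Y. smooth X \<longrightarrow> smooth X' \<longrightarrow> smooth Y \<longrightarrow>
        nabla (\<lambda>x. X x + X' x) Y = (\<lambda>x. nabla X Y x + nabla X' Y x)) \<and>
     (\<forall>(g :: real^'n \<Rightarrow> real) X Y. smooth g \<longrightarrow> smooth X \<longrightarrow> smooth Y \<longrightarrow>
        nabla (\<lambda>x. g x *\<^sub>R X x) Y = (\<lambda>x. g x *\<^sub>R nabla X Y x)) \<and>
     (\<forall>X Y Y'. smooth X \<longrightarrow> smooth Y \<longrightarrow> smooth Y' \<longrightarrow>
        nabla X (\<lambda>x. Y x + Y' x) = (\<lambda>x. nabla X Y x + nabla X Y' x)) \<and>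
     (\<forall>(g :: real^'n \<Rightarrow> real) X Y. smooth g \<longrightarrow> smooth X \<longrightarrow> smooth Y \<longrightarrow>
        nabla X (\<lambda>x. g x *\<^sub>R Y x) =
          (\<lambda>x. dir_deriv X g x *\<^sub>R Y x + g x *\<^sub>R nabla X Y x)) \<and>
     (\<forall>X Y. smooth X \<longrightarrow> smooth Y \<longrightarrow>
        (\<lambda>x. nabla X Y x - nabla Y X x) = lie_bracket X Y)"

definition christoffel ::
  "((real^'n \<Rightarrow> real^'n) \<Rightarrow> (real^'n \<Rightarrow> real^'n) \<Rightarrow> (real^'n \<Rightarrow> real^'n))
     \<Rightarrow> 'n \<Rightarrow> 'n \<Rightarrow> 'n \<Rightarrow> real^'n \<Rightarrow> real" where
  "christoffel nabla k i j x = nabla (\<lambda>_. axis i 1) (\<lambda>_. axis j 1) x $ k"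

text \<open>The coordinate form of \<open>\<nabla>\<close>-autoparallelism of \<open>\<gamma>'\<close> along \<open>\<gamma>\<close>. Derivatives at the
  end points are one-sided. The Christoffel symbols of a connection are smooth, so the equation
  makes every such curve smooth.\<close>

definition geodesic ::
  "((real^'n \<Rightarrow> real^'n) \<Rightarrow> (real^'n \<Rightarrow> real^'n) \<Rightarrow> (real^'n \<Rightarrow> real^'n))
     \<Rightarrow> (real \<Rightarrow> real^'n) \<Rightarrow> bool" where
  "geodesic nabla \<gamma> \<longleftrightarrow> (\<exists>\<gamma>' \<gamma>''. \<forall>t\<in>{0..1}.
     (\<gamma> has_vector_derivative \<gamma>' t) (at t within {0..1}) \<and>
     (\<gamma>' has_vector_derivative \<gamma>'' t) (at t within {0..1}) \<and>
     (\<forall>k. \<gamma>'' t $ k +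
        (\<Sum>i\<in>UNIV. \<Sum>j\<in>UNIV. christoffel nabla k i j (\<gamma> t) * \<gamma>' t $ i * \<gamma>' t $ j) = 0))"

definition g_convex ::
  "((real^'n \<Rightarrow> real^'n) \<Rightarrow> (real^'n \<Rightarrow> real^'n) \<Rightarrow> (real^'n \<Rightarrow> real^'n))
     \<Rightarrow> (real^'n \<Rightarrow> real) \<Rightarrow> bool" where
  "g_convex nabla f \<longleftrightarrow> (\<forall>\<gamma>. geodesic nabla \<gamma> \<longrightarrow> convex_on {0..1} (f \<circ> \<gamma>))"

definition critical_point :: "(real^'n \<Rightarrow> real) \<Rightarrow> real^'n \<Rightarrow> bool" where
  "critical_point f x \<longleftrightarrow> (f has_derivative (\<lambda>_. 0)) (at x)"

definition partial_deriv :: "'n \<Rightarrow> (real^'n \<Rightarrow> real) \<Rightarrow> real^'n \<Rightarrow> real" where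
  "partial_deriv i f x = frechet_derivative f (at x) (axis i 1)"

definition hessian_matrix :: "(real^'n \<Rightarrow> real) \<Rightarrow> real^'n \<Rightarrow> real^'n^'n" where
  "hessian_matrix f x = (\<chi> i j. partial_deriv i (partial_deriv j f) x)"

definition pos_semidef :: "real^'n^'n \<Rightarrow> bool" where
  "pos_semidef A \<longleftrightarrow> transpose A = A \<and> (\<forall>v. 0 \<le> v \<bullet> (A *v v))"

end

theory Submission imports Defs begin

text \<open>A geodesic \<open>\<gamma>\<close> starting at a critical point \<open>p\<close> with velocity \<open>w\<close> satisfies
  \<open>(f \<circ> \<gamma>)'(0) = 0\<close> and \<open>(f \<circ> \<gamma>)''(0) = w \<bullet> H w + df(\<gamma>''(0)) = w \<bullet> H w\<close>, so convexity of
  \<open>f \<circ> \<gamma>\<close> forces \<open>w \<bullet> H w \<ge> 0\<close>. Geodesics with a small multiple of any given initial velocity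
  exist on \<open>[0,1]\<close> by the Picard-Lindeloef theorem and rescaling of time.\<close>

section \<open>Local solutions of autonomous ordinary differential equations\<close>

text \<open>The Picard operator is a contraction for small \<open>h\<close>, so Banach's fixed point
  theorem gives a solution of the integral equation, and the fundamental theorem of calculus turns
  it into a solution of the differential equation. Forward time is enough for geodesics that start
  at a given point.\<close>

lemma picard_lindelof:
  fixes F :: "'a::banach \<Rightarrow> 'a"
  assumes r: "0 < r" and L: "L-lipschitz_on (cball z0 r) F"
  obtains h z where "0 < h" "z 0 = z0"
    "\<And>t. t \<in> {0..h} \<Longrightarrow> (z has_vector_derivative F (z t)) (at t within {0..h})"
proof -
  have L0: "0 \<le> L" using L by (rule lipschitz_on_nonneg)
  define B where "B = norm (F z0) + L * r"
  have B0: "0 \<le> B" using L0 r by (simp add: B_def)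
  have FB: "norm (F y) \<le> B" if "y \<in> cball z0 r" for y
  proof -
    have "norm (F y) \<le> norm (F z0) + dist (F y) (F z0)"
      by (metis dist_norm norm_triangle_sub)
    also have "dist (F y) (F z0) \<le> L * dist y z0"
      using lipschitz_onD[OF L] that r by simp
    also have "\<dots> \<le> L * r"
      using that L0 by (intro mult_left_mono) (auto simp: dist_commute)
    finally show ?thesis by (simp add: B_def)
  qed
  \<comment> \<open>The first bound gives \<open>B * h \<le> r\<close>, which keeps Picard iterates
    inside the ball; the second gives \<open>L * h \<le> 1/2\<close>, the contraction factor. The
    added 1 keeps the denominators positive when \<open>B\<close> or \<open>L\<close> is 0.\<close>
  define h where "h = min (r / (B + 1)) (1 / (2 * (L + 1)))"
  have h0: "0 < h" using r B0 L0 by (simp add: h_def)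
  have "B * h \<le> B * (r / (B + 1))"
    using B0 by (intro mult_left_mono) (auto simp: h_def)
  also have "\<dots> \<le> r" using B0 r by (simp add: field_simps)
  finally have Bh: "B * h \<le> r" .
  have "L * h \<le> L * (1 / (2 * (L + 1)))"
    using L0 by (intro mult_left_mono) (auto simp: h_def)
  also have "\<dots> \<le> 1/2" using L0 by (simp add: field_simps)
  finally have Lh: "L * h \<le> 1/2" .
  \<comment> \<open>Bounded continuous functions form a complete space only as functions on the
    whole line here, so time is clamped to \<open>{0..h}\<close>: images under the Picard operator
    are constant outside this interval.\<close>
  define c :: "real \<Rightarrow> real" where "c t = max 0 (min h t)" for t
  have c: "c t \<in> {0..h}" for t using h0 by (auto simp: c_def)
  have cont_c: "continuous_on UNIV c"
    unfolding c_def by (intro continuous_intros)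
  \<comment> \<open>The Lipschitz bound on \<open>F\<close> holds only on the ball, so the fixed
    point is sought among functions with values in it. This set is closed, hence complete.\<close>
  define S :: "(real \<Rightarrow>\<^sub>C 'a) set" where "S = PiC UNIV (\<lambda>_. cball z0 r)"
  have S_iff: "z \<in> S \<longleftrightarrow> (\<forall>t. apply_bcontfun z t \<in> cball z0 r)" for z
    by (auto simp: S_def mem_PiC_iff)
  define P where "P z t = z0 + integral {0..c t} (\<lambda>s. F (apply_bcontfun z s))"
    for z :: "real \<Rightarrow>\<^sub>C 'a" and t
  have contF: "continuous_on A (\<lambda>s. F (apply_bcontfun z s))" if "z \<in> S" for z A
    using that S_iff
    by (intro continuous_on_compose2[OF lipschitz_on_continuous_on[OF L]]) auto
  have P_ball: "P z t \<in> cball z0 r" if z: "z \<in> S" for z t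
  proof -
    have "norm (integral {0..c t} (\<lambda>s. F (apply_bcontfun z s))) \<le> B * (c t - 0)"
      using c[of t] z S_iff FB by (intro integral_bound contF) auto
    also have "\<dots> \<le> B * h" using c[of t] B0 by (intro mult_left_mono) auto
    finally show ?thesis using Bh by (simp add: P_def dist_norm)
  qed
  have P_bcont: "P z \<in> bcontfun" if z: "z \<in> S" for z
  proof -
    have "continuous_on {0..h} (\<lambda>x. integral {0..x} (\<lambda>s. F (apply_bcontfun z s)))"
      by (intro indefinite_integral_continuous_1 integrable_continuous_real contF z)
    then have "continuous_on UNIV (\<lambda>t. integral {0..c t} (\<lambda>s. F (apply_bcontfun z s)))"
      by (rule continuous_on_compose2[OF _ cont_c]) (use c in auto)
    then have "continuous_on UNIV (P z)"
      unfolding P_def by (intro continuous_intros)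
    moreover have "bounded (range (P z))"
      using P_ball[OF z] by (intro bounded_subset[OF bounded_cball[of z0 r]]) blast
    ultimately show ?thesis by (simp add: bcontfun_def)
  qed
  have ap: "apply_bcontfun (Bcontfun (P z)) = P z" if "z \<in> S" for z
    using P_bcont[OF that] by (simp add: Bcontfun_inverse)
  have "\<exists>!z. z \<in> S \<and> Bcontfun (P z) = z"
  proof (rule Banach_fix[where c = "1/2"])
    show "complete S"
      unfolding S_def complete_eq_closed by (intro closed_PiC) auto
    have "const_bcontfun z0 \<in> S" using r by (simp add: S_iff const_bcontfun.rep_eq)
    then show "S \<noteq> {}" by blast
    show "(\<lambda>z. Bcontfun (P z)) ` S \<subseteq> S"
      using P_ball ap by (auto simp: S_iff simp del: mem_cball)
    show "dist (Bcontfun (P x)) (Bcontfun (P y)) \<le> 1/2 * dist x y" if x: "x \<in> S" and y: "y \<in> S" for x y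
    proof (rule dist_bound)
      fix t
      let ?x = "\<lambda>s. F (apply_bcontfun x s)" and ?y = "\<lambda>s. F (apply_bcontfun y s)"
      have "norm (integral {0..c t} (\<lambda>s. ?x s - ?y s)) \<le> (L * dist x y) * (c t - 0)"
      proof (rule integral_bound)
        show "continuous_on {0..c t} (\<lambda>s. ?x s - ?y s)"
          by (intro continuous_intros contF x y)
        fix s
        have "norm (?x s - ?y s) \<le> L * dist (apply_bcontfun x s) (apply_bcontfun y s)"
          using lipschitz_onD[OF L] x y S_iff by (simp add: dist_norm)
        also have "\<dots> \<le> L * dist x y"
          by (intro mult_left_mono dist_bounded L0)
        finally show "norm (?x s - ?y s) \<le> L * dist x y" .
      qed (use c in auto)
      also have "\<dots> \<le> (L * dist x y) * h"
        using c[of t] L0 by (intro mult_left_mono) auto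
      also have "\<dots> = (L * h) * dist x y" by simp
      also have "\<dots> \<le> 1/2 * dist x y" by (intro mult_right_mono Lh) auto
      also have "integral {0..c t} (\<lambda>s. ?x s - ?y s) = P x t - P y t"
        unfolding P_def
        by (subst integral_diff) (auto intro!: integrable_continuous_real contF x y)
      finally show "dist (apply_bcontfun (Bcontfun (P x)) t) (apply_bcontfun (Bcontfun (P y)) t) \<le> 1/2 * dist x y"
        by (simp add: ap x y dist_norm)
    qed
  qed auto
  then obtain w where w: "w \<in> S" "Bcontfun (P w) = w" by blast
  then have wP: "apply_bcontfun w t = P w t" for t using ap by metis
  show ?thesis
  proof
    show "0 < h" by (rule h0)
    show "apply_bcontfun w 0 = z0" unfolding wP by (simp add: P_def c_def)
    fix t assume t: "t \<in> {0..h}"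
    have "((\<lambda>u. z0 + integral {0..u} (\<lambda>s. F (apply_bcontfun w s)))
        has_vector_derivative 0 + F (apply_bcontfun w t)) (at t within {0..h})"
      by (intro has_vector_derivative_add has_vector_derivative_const
          integral_has_vector_derivative contF w t)
    then have int: "((\<lambda>u. z0 + integral {0..u} (\<lambda>s. F (apply_bcontfun w s)))
        has_vector_derivative F (apply_bcontfun w t)) (at t within {0..h})" by simp
    \<comment> \<open>On \<open>{0..h}\<close> the clamp is the identity, so the fixed point
      equation is the genuine integral equation.\<close>
    have "apply_bcontfun w u = z0 + integral {0..u} (\<lambda>s. F (apply_bcontfun w s))" if "u \<in> {0..h}" for u
      using wP[of u] that by (simp add: P_def c_def)
    then show "(apply_bcontfun w has_vector_derivative F (apply_bcontfun w t)) (at t within {0..h})"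
      by (rule has_vector_derivative_transform[OF t _ int])
  qed
qed

section \<open>Lipschitz bounds on compact sets\<close>

text \<open>Each directional derivative along a basis vector is continuous, hence bounded on the
  compact ball. The sum of these bounds controls the operator norm of the derivative, and the ball
  is convex, so the mean value inequality applies.\<close>

lemma Ck_Suc_imp_lipschitz_on_cball:
  fixes g :: "'a::euclidean_space \<Rightarrow> 'b::real_normed_vector"
  assumes "Ck (Suc 0) g"
  shows "\<exists>L. L-lipschitz_on (cball x r) g"
proof -
  have diff: "(g has_derivative frechet_derivative g (at y)) (at y)" for y
    using assms by (simp add: frechet_derivative_works)
  have "\<exists>C. \<forall>y\<in>cball x r. norm (frechet_derivative g (at y) b) \<le> C" for b
  proof -
    have "continuous_on (cball x r) (\<lambda>y. frechet_derivative g (at y) b)"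
      using assms continuous_on_subset by fastforce
    then have "bounded ((\<lambda>y. frechet_derivative g (at y) b) ` cball x r)"
      by (intro compact_imp_bounded compact_continuous_image) auto
    then show ?thesis by (auto simp: bounded_iff)
  qed
  then obtain C where C: "\<And>b y. y \<in> cball x r \<Longrightarrow> norm (frechet_derivative g (at y) b) \<le> C b"
    by metis
  \<comment> \<open>For negative \<open>r\<close> the ball is empty and \<open>C\<close> is
    arbitrary; the maximum with 0 still yields an admissible Lipschitz constant.\<close>
  define K where "K = max 0 (\<Sum>b\<in>Basis. C b)"
  have "K-lipschitz_on (cball x r) g"
  proof (rule bounded_derivative_imp_lipschitz)
    show "(g has_derivative frechet_derivative g (at y)) (at y within cball x r)" for y
      using diff has_derivative_at_withinI by blast
    show "onorm (frechet_derivative g (at y)) \<le> K" if "y \<in> cball x r" for y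
    proof -
      have "onorm (frechet_derivative g (at y)) \<le> (\<Sum>b\<in>Basis. norm (frechet_derivative g (at y) b))"
        using diff has_derivative_bounded_linear by (intro onorm_componentwise) blast
      also have "\<dots> \<le> (\<Sum>b\<in>Basis. C b)" using C that by (intro sum_mono) auto
      finally show ?thesis by (simp add: K_def)
    qed
  qed (auto simp: K_def)
  then show ?thesis by blast
qed

text \<open>Lipschitz functions are bounded on a compact set, which makes the product rule for
  differences effective. With the constants hidden by existential quantifiers, this and the next two
  lemmas compose to cover the right-hand side of the geodesic equation.\<close>

lemma ex_lipschitz_on_mult:
  fixes f g :: "'a::metric_space \<Rightarrow> real"
  assumes "compact S" and f: "\<exists>L. L-lipschitz_on S f" and g: "\<exists>L. L-lipschitz_on S g"
  shows "\<exists>L. L-lipschitz_on S (\<lambda>x. f x * g x)"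
proof -
  obtain L M where L: "L-lipschitz_on S f" and M: "M-lipschitz_on S g" using f g by blast
  have "bounded (f ` S)" "bounded (g ` S)"
    using lipschitz_on_continuous_on[OF L] lipschitz_on_continuous_on[OF M] \<open>compact S\<close>
    by (simp_all add: compact_continuous_image compact_imp_bounded)
  then obtain A B where A: "0 < A" "\<And>x. x \<in> S \<Longrightarrow> \<bar>f x\<bar> \<le> A" and B: "0 < B" "\<And>x. x \<in> S \<Longrightarrow> \<bar>g x\<bar> \<le> B"
    by (auto simp: bounded_pos)
  have "(A * M + B * L)-lipschitz_on S (\<lambda>x. f x * g x)"
  proof (rule lipschitz_onI)
    fix x y assume xy: "x \<in> S" "y \<in> S"
    have "f x * g x - f y * g y = f x * (g x - g y) + g y * (f x - f y)"
      by (simp add: algebra_simps)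
    then have "\<bar>f x * g x - f y * g y\<bar> \<le> \<bar>f x\<bar> * \<bar>g x - g y\<bar> + \<bar>g y\<bar> * \<bar>f x - f y\<bar>"
      by (metis abs_mult abs_triangle_ineq)
    also have "\<dots> \<le> A * (M * dist x y) + B * (L * dist x y)"
      using lipschitz_onD[OF L xy] lipschitz_onD[OF M xy] A B xy
      by (intro add_mono mult_mono) (auto simp: dist_real_def)
    finally show "dist (f x * g x) (f y * g y) \<le> (A * M + B * L) * dist x y"
      by (simp add: dist_real_def algebra_simps)
  qed (use A B lipschitz_on_nonneg[OF L] lipschitz_on_nonneg[OF M] in simp)
  then show ?thesis by blast
qed

lemma ex_lipschitz_on_sum:
  fixes f :: "'i \<Rightarrow> 'a::metric_space \<Rightarrow> 'b::real_normed_vector"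
  assumes "finite I" "\<And>i. i \<in> I \<Longrightarrow> \<exists>L. L-lipschitz_on S (f i)"
  shows "\<exists>L. L-lipschitz_on S (\<lambda>x. \<Sum>i\<in>I. f i x)"
  using assms
proof (induction I rule: finite_induct)
  case empty
  then show ?case using lipschitz_on_constant by fastforce
next
  case (insert i I)
  then obtain L M where "L-lipschitz_on S (f i)" "M-lipschitz_on S (\<lambda>x. \<Sum>i\<in>I. f i x)"
    by (metis insert_iff)
  then show ?case using insert lipschitz_on_add by fastforce
qed

lemma ex_lipschitz_on_vec:
  fixes f :: "'n::finite \<Rightarrow> 'a::metric_space \<Rightarrow> real"
  assumes "\<And>k. \<exists>L. L-lipschitz_on S (f k)"
  shows "\<exists>L. L-lipschitz_on S (\<lambda>x. \<chi> k. f k x)"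
proof -
  obtain L where L: "\<And>k. (L k)-lipschitz_on S (f k)" using assms by metis
  have "(\<Sum>k\<in>UNIV. L k)-lipschitz_on S (\<lambda>x. \<chi> k. f k x)"
  proof (rule lipschitz_onI)
    fix x y assume xy: "x \<in> S" "y \<in> S"
    have "dist (\<chi> k. f k x) (\<chi> k. f k y) \<le> (\<Sum>k\<in>UNIV. \<bar>f k x - f k y\<bar>)"
      using norm_le_l1_cart[of "(\<chi> k. f k x) - (\<chi> k. f k y)"] by (simp add: dist_norm)
    also have "\<dots> \<le> (\<Sum>k\<in>UNIV. L k * dist x y)"
      using lipschitz_onD[OF L xy] by (intro sum_mono) (simp add: dist_real_def)
    finally show "dist (\<chi> k. f k x) (\<chi> k. f k y) \<le> (\<Sum>k\<in>UNIV. L k) * dist x y"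
      by (simp add: sum_distrib_right)
  qed (use L lipschitz_on_nonneg in \<open>blast intro: sum_nonneg\<close>)
  then show ?thesis by blast
qed

section \<open>Christoffel symbols and existence of geodesics\<close>

lemma smooth_const: "smooth (\<lambda>_. c)"
proof -
  have "Ck k (\<lambda>_::'a. c)" for k and c :: 'b
    by (induction k arbitrary: c) (auto simp: frechet_derivative_const)
  then show ?thesis by (simp add: smooth_def)
qed

text \<open>The coordinate fields are constant, hence smooth, and a connection maps smooth fields to
  smooth fields; taking a component does not increase distances.\<close>

lemma christoffel_lipschitz_on_cball:
  assumes "torsion_free_connection nabla"
  shows "\<exists>L. L-lipschitz_on (cball p r) (christoffel nabla k i j)"
proof -
  have "smooth (nabla (\<lambda>_. axis i 1) (\<lambda>_. axis j 1))"
    using assms unfolding torsion_free_connection_def by (blast intro: smooth_const)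
  then obtain L where L: "L-lipschitz_on (cball p r) (nabla (\<lambda>_. axis i 1) (\<lambda>_. axis j 1))"
    using Ck_Suc_imp_lipschitz_on_cball unfolding smooth_def by blast
  have "L-lipschitz_on (cball p r) (christoffel nabla k i j)"
  proof (rule lipschitz_onI)
    fix x y assume xy: "x \<in> cball p r" "y \<in> cball p r"
    show "dist (christoffel nabla k i j x) (christoffel nabla k i j y) \<le> L * dist x y"
      using order_trans[OF dist_vec_nth_le lipschitz_onD[OF L xy]]
      by (simp add: christoffel_def)
  qed (rule lipschitz_on_nonneg[OF L])
  then show ?thesis by blast
qed

text \<open>The geodesic equation is a first-order system for position and velocity. Its local
  solution lives on some \<open>{0..h}\<close>; traversing it \<open>h\<close> times as fast moves
  it to \<open>{0..1}\<close> and scales the initial velocity, so \<open>e\<close> is this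
  \<open>h\<close>.\<close>

lemma geodesic_exists:
  fixes p v :: "real^'n"
  assumes "torsion_free_connection nabla"
  obtains e \<gamma> where "0 < e" "geodesic nabla \<gamma>" "\<gamma> 0 = p"
    "(\<gamma> has_vector_derivative e *\<^sub>R v) (at 0 within {0..1})"
proof -
  define acc :: "(real^'n) \<times> (real^'n) \<Rightarrow> real^'n" where
    "acc z = - (\<chi> k. \<Sum>i\<in>UNIV. \<Sum>j\<in>UNIV. christoffel nabla k i j (fst z) * snd z $ i * snd z $ j)" for z
  define F where "F z = (snd z, acc z)" for z
  let ?S = "cball (p, v) 1"
  have fst_lip: "1-lipschitz_on ?S fst" and snd_lip: "1-lipschitz_on ?S snd"
    by (rule lipschitz_onI; simp add: dist_fst_le dist_snd_le)+
  have comp: "\<exists>L. L-lipschitz_on ?S (\<lambda>z. snd z $ i)" for i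
  proof -
    have "1-lipschitz_on ?S (\<lambda>z. snd z $ i)"
      by (rule lipschitz_onI) (auto intro: order_trans[OF dist_vec_nth_le dist_snd_le])
    then show ?thesis by blast
  qed
  have chr: "\<exists>L. L-lipschitz_on ?S (\<lambda>z. christoffel nabla k i j (fst z))" for k i j
  proof -
    obtain L where L: "L-lipschitz_on (cball p 1) (christoffel nabla k i j)"
      using christoffel_lipschitz_on_cball[OF assms] by blast
    have "fst ` ?S \<subseteq> cball p 1"
    proof (rule image_subsetI)
      show "fst y \<in> cball p 1" if "y \<in> ?S" for y
        using dist_fst_le[of "(p, v)" y] that by simp
    qed
    then show ?thesis
      using lipschitz_on_compose2[OF fst_lip] lipschitz_on_subset[OF L] by blast
  qed
  have "\<exists>L. L-lipschitz_on ?S (\<lambda>z. \<chi> k. \<Sum>i\<in>UNIV. \<Sum>j\<in>UNIV.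
      christoffel nabla k i j (fst z) * snd z $ i * snd z $ j)"
    by (intro ex_lipschitz_on_vec ex_lipschitz_on_sum ex_lipschitz_on_mult finite compact_cball comp chr)
  then obtain M where "M-lipschitz_on ?S acc"
    unfolding acc_def using lipschitz_on_minus by blast
  then obtain L where "L-lipschitz_on ?S F"
    unfolding F_def using lipschitz_on_Pair[OF snd_lip] by blast
  then obtain h z where h: "0 < h" and z0: "z 0 = (p, v)"
    and z: "\<And>t. t \<in> {0..h} \<Longrightarrow> (z has_vector_derivative F (z t)) (at t within {0..h})"
    using picard_lindelof[of 1] by (metis zero_less_one)
  have scaled: "((\<lambda>t. z (h * t)) has_vector_derivative h *\<^sub>R F (z (h * t))) (at t within {0..1})"
    if "t \<in> {0..1}" for t
  proof -
    have "((*) h has_vector_derivative h) (at t within {0..1})"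
      by (auto intro!: derivative_eq_intros)
    moreover have "(z has_vector_derivative F (z (h * t))) (at (h * t) within (*) h ` {0..1})"
      using h that by (intro has_vector_derivative_within_subset[OF z])
        (auto simp: mult_left_le)
    ultimately show ?thesis
      using vector_diff_chain_within by (fastforce simp: o_def)
  qed
  define \<gamma> where "\<gamma> t = fst (z (h * t))" for t
  define \<gamma>' where "\<gamma>' t = h *\<^sub>R snd (z (h * t))" for t
  define \<gamma>'' where "\<gamma>'' t = h *\<^sub>R h *\<^sub>R acc (z (h * t))" for t
  have 1: "(\<gamma> has_vector_derivative \<gamma>' t) (at t within {0..1})" if "t \<in> {0..1}" for t
    using bounded_linear.has_vector_derivative[OF bounded_linear_fst scaled[OF that]]
    by (simp add: \<gamma>_def[abs_def] \<gamma>'_def F_def)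
  have 2: "(\<gamma>' has_vector_derivative \<gamma>'' t) (at t within {0..1})" if "t \<in> {0..1}" for t
    using bounded_linear.has_vector_derivative[OF bounded_linear_scaleR_right
        bounded_linear.has_vector_derivative[OF bounded_linear_snd scaled[OF that]], of h]
    by (simp add: \<gamma>'_def[abs_def] \<gamma>''_def F_def)
  \<comment> \<open>The change of time multiplies the acceleration by \<open>h\<^sup>2\<close>. The
    Christoffel term is quadratic in the velocity and gains the same factor, so the equation
    survives.\<close>
  have 3: "\<gamma>'' t $ k + (\<Sum>i\<in>UNIV. \<Sum>j\<in>UNIV. christoffel nabla k i j (\<gamma> t) * \<gamma>' t $ i * \<gamma>' t $ j) = 0" for t k
    by (simp add: \<gamma>_def \<gamma>'_def \<gamma>''_def acc_def sum_distrib_left algebra_simps)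
  have "geodesic nabla \<gamma>"
    unfolding geodesic_def using 1 2 3 by blast
  moreover have "\<gamma> 0 = p" "(\<gamma> has_vector_derivative h *\<^sub>R v) (at 0 within {0..1})"
    using 1[of 0] z0 by (auto simp: \<gamma>_def \<gamma>'_def)
  ultimately show ?thesis using that h by blast
qed

section \<open>Symmetry of second derivatives\<close>

text \<open>Both mixed derivatives are limits of the second difference quotient
  \<open>(f(x+ta+tb) - f(x+ta) - f(x+tb) + f x) / t\<^sup>2\<close>, by two applications of the mean value theorem.\<close>

lemma second_difference_limit:
  fixes f :: "'a::euclidean_space \<Rightarrow> real"
  assumes "Ck (Suc (Suc 0)) f"
  shows "((\<lambda>t. (f (x + t *\<^sub>R a + t *\<^sub>R b) - f (x + t *\<^sub>R a) - f (x + t *\<^sub>R b) + f x) / t\<^sup>2) \<longlongrightarrow>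
     frechet_derivative (\<lambda>y. frechet_derivative f (at y) a) (at x) b) (at_right 0)"
    (is "(?Q \<longlongrightarrow> ?D x) _")
proof -
  let ?fa = "\<lambda>y. frechet_derivative f (at y) a"
  have df: "(f has_derivative frechet_derivative f (at y)) (at y)" for y
    using assms by (simp add: frechet_derivative_works)
  have dfa: "(?fa has_derivative frechet_derivative ?fa (at y)) (at y)" for y
    using assms by (simp add: frechet_derivative_works)
  have contD: "continuous_on UNIV ?D" using assms by simp
  have line: "((\<lambda>s. g (y + s *\<^sub>R w)) has_real_derivative frechet_derivative g (at (y + s *\<^sub>R w)) w) (at s)"
    if "\<And>y. (g has_derivative frechet_derivative g (at y)) (at y)"
    for g :: "'a \<Rightarrow> real" and y w s
  proof -
    have "((\<lambda>s. y + s *\<^sub>R w) has_derivative (\<lambda>u. u *\<^sub>R w)) (at s)"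
      by (auto intro!: derivative_eq_intros)
    from has_derivative_compose[OF this that]
    have "((\<lambda>s. g (y + s *\<^sub>R w)) has_derivative (\<lambda>u. frechet_derivative g (at (y + s *\<^sub>R w)) (u *\<^sub>R w))) (at s)" .
    moreover have "frechet_derivative g (at (y + s *\<^sub>R w)) (u *\<^sub>R w)
        = frechet_derivative g (at (y + s *\<^sub>R w)) w * u" for u
      using linear_cmul[OF has_derivative_linear[OF that]] by simp
    ultimately show ?thesis by (simp add: has_field_derivative_def)
  qed
  have Q: "\<exists>\<sigma> \<tau>. 0 < \<sigma> \<and> \<sigma> < t \<and> 0 < \<tau> \<and> \<tau> < t \<and> ?Q t = ?D (x + \<sigma> *\<^sub>R a + \<tau> *\<^sub>R b)" if t: "0 < t" for t
  proof -
    \<comment> \<open>The increment of \<open>f\<close> in direction \<open>b\<close> is taken as a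
      function of the displacement along \<open>a\<close>. Then \<open>\<phi> t - \<phi> 0\<close>
      is the numerator of the quotient; the mean value theorem is applied to it along
      \<open>a\<close>, then to \<open>?fa\<close> along \<open>b\<close>.\<close>
    define \<phi> where "\<phi> s = f ((x + t *\<^sub>R b) + s *\<^sub>R a) - f (x + s *\<^sub>R a)" for s
    have "(\<phi> has_real_derivative ?fa ((x + t *\<^sub>R b) + s *\<^sub>R a) - ?fa (x + s *\<^sub>R a)) (at s)" for s
      unfolding \<phi>_def by (intro DERIV_diff line df)
    then obtain \<sigma> where \<sigma>: "0 < \<sigma>" "\<sigma> < t"
      "\<phi> t - \<phi> 0 = (t - 0) * (?fa ((x + t *\<^sub>R b) + \<sigma> *\<^sub>R a) - ?fa (x + \<sigma> *\<^sub>R a))"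
      using MVT2[OF t, of \<phi> "\<lambda>s. ?fa ((x + t *\<^sub>R b) + s *\<^sub>R a) - ?fa (x + s *\<^sub>R a)"] by blast
    have "((\<lambda>s. ?fa ((x + \<sigma> *\<^sub>R a) + s *\<^sub>R b)) has_real_derivative ?D (x + \<sigma> *\<^sub>R a + s *\<^sub>R b)) (at s)" for s
      by (rule line[of ?fa, OF dfa])
    then obtain \<tau> where \<tau>: "0 < \<tau>" "\<tau> < t"
      "?fa ((x + \<sigma> *\<^sub>R a) + t *\<^sub>R b) - ?fa ((x + \<sigma> *\<^sub>R a) + 0 *\<^sub>R b) = (t - 0) * ?D (x + \<sigma> *\<^sub>R a + \<tau> *\<^sub>R b)"
      using MVT2[OF t, of "\<lambda>s. ?fa ((x + \<sigma> *\<^sub>R a) + s *\<^sub>R b)" "\<lambda>s. ?D (x + \<sigma> *\<^sub>R a + s *\<^sub>R b)"] by blast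
    have "\<phi> t - \<phi> 0 = t * (t * ?D (x + \<sigma> *\<^sub>R a + \<tau> *\<^sub>R b))"
      using \<sigma>(3) \<tau>(3) by (simp add: ac_simps)
    moreover have "\<phi> t - \<phi> 0 = f (x + t *\<^sub>R a + t *\<^sub>R b) - f (x + t *\<^sub>R a) - f (x + t *\<^sub>R b) + f x"
      by (simp add: \<phi>_def ac_simps)
    ultimately have "?Q t = ?D (x + \<sigma> *\<^sub>R a + \<tau> *\<^sub>R b)"
      using t by (simp add: power2_eq_square)
    then show ?thesis using \<sigma> \<tau> by blast
  qed
  then obtain \<sigma> \<tau> where st: "\<And>t. 0 < t \<Longrightarrow> 0 < \<sigma> t \<and> \<sigma> t < t \<and> 0 < \<tau> t \<and> \<tau> t < t \<and>
      ?Q t = ?D (x + \<sigma> t *\<^sub>R a + \<tau> t *\<^sub>R b)"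
    by metis
  have pos: "eventually (\<lambda>t::real. 0 < t) (at_right 0)"
    by (simp add: eventually_at_right_less)
  have small: "(\<rho> \<longlongrightarrow> 0) (at_right 0)" if "\<And>t. 0 < t \<Longrightarrow> 0 < \<rho> t \<and> \<rho> t < t" for \<rho> :: "real \<Rightarrow> real"
  proof (rule tendsto_sandwich[of "\<lambda>_. 0" _ _ "\<lambda>t. t"])
    show "\<forall>\<^sub>F t in at_right 0. 0 \<le> \<rho> t" "\<forall>\<^sub>F t in at_right 0. \<rho> t \<le> t"
      by (rule eventually_mono[OF pos]; use that in force)+
  qed (auto intro: tendsto_ident_at)
  \<comment> \<open>Both intermediate parameters lie between 0 and \<open>t\<close>, so the
    evaluation points converge to \<open>x\<close>, where \<open>?D\<close> is continuous.\<close>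
  have "((\<lambda>t. x + \<sigma> t *\<^sub>R a + \<tau> t *\<^sub>R b) \<longlongrightarrow> x + 0 *\<^sub>R a + 0 *\<^sub>R b) (at_right 0)"
    by (intro tendsto_intros small) (use st in blast)+
  moreover have "isCont ?D x" using contD by (simp add: continuous_on_eq_continuous_at)
  ultimately have "((\<lambda>t. ?D (x + \<sigma> t *\<^sub>R a + \<tau> t *\<^sub>R b)) \<longlongrightarrow> ?D x) (at_right 0)"
    using isCont_tendsto_compose by fastforce
  then show ?thesis
    by (rule Lim_transform_eventually) (rule eventually_mono[OF pos], use st in simp)
qed

lemma frechet_derivative_commute:
  fixes f :: "'a::euclidean_space \<Rightarrow> real"
  assumes "Ck (Suc (Suc 0)) f"
  shows "frechet_derivative (\<lambda>y. frechet_derivative f (at y) a) (at x) b =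
    frechet_derivative (\<lambda>y. frechet_derivative f (at y) b) (at x) a"
proof -
  have swap: "(\<lambda>t. (f (x + t *\<^sub>R a + t *\<^sub>R b) - f (x + t *\<^sub>R a) - f (x + t *\<^sub>R b) + f x) / t\<^sup>2) =
    (\<lambda>t. (f (x + t *\<^sub>R b + t *\<^sub>R a) - f (x + t *\<^sub>R b) - f (x + t *\<^sub>R a) + f x) / t\<^sup>2)"
    by (rule ext) (simp add: algebra_simps)
  show ?thesis
    by (rule tendsto_unique[OF trivial_limit_at_right_real
          second_difference_limit[OF assms, of x a b, unfolded swap]
          second_difference_limit[OF assms, of x b a]])
qed

section \<open>Convex functions of one variable with a critical left end point\<close>

text \<open>If \<open>c\<close> were negative, \<open>g'\<close> would be negative just to the right
  of 0, so \<open>g\<close> would drop below \<open>g 0\<close> at some \<open>t\<close>. The chord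
  from 0 to \<open>t\<close> then descends, while the graph leaves 0 horizontally and so rises above
  the chord, against convexity.\<close>

lemma convex_on_second_derivative_nonneg:
  fixes g g' :: "real \<Rightarrow> real"
  assumes conv: "convex_on {0..1} g"
    and g: "\<And>t. t \<in> {0..1} \<Longrightarrow> (g has_real_derivative g' t) (at t within {0..1})"
    and "g' 0 = 0"
    and g': "(g' has_real_derivative c) (at 0 within {0..1})"
  shows "0 \<le> c"
proof (rule ccontr)
  assume "\<not> 0 \<le> c"
  then obtain d where d: "0 < d" "\<And>u. 0 < u \<Longrightarrow> u \<in> {0..1} \<Longrightarrow> u < d \<Longrightarrow> g' u < 0"
    using has_real_derivative_neg_dec_right[OF g'] \<open>g' 0 = 0\<close> by auto
  define t where "t = min (d / 2) 1"
  have t: "0 < t" "t \<le> 1" "t < d" using d(1) by (auto simp: t_def)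
  have "\<exists>u\<in>{0<..<t}. g t - g 0 = g' u * (t - 0)"
    using t by (intro mvt_simple)
      (auto intro!: has_derivative_subset[OF g[unfolded has_field_derivative_def]])
  then obtain u where u: "0 < u" "u < t" "g t - g 0 = g' u * t" by auto
  have "g' u < 0" using d(2) u t by auto
  then have less: "g t - g 0 < 0" using u t by (simp add: mult_neg_pos)
  define m where "m = (g t - g 0) / t"
  have m: "m < 0" using less t by (simp add: m_def field_simps)
  \<comment> \<open>The difference between the graph and the chord has slope \<open>- m > 0\<close>
    at 0, hence is positive at small \<open>s > 0\<close>.\<close>
  have "((\<lambda>s. g s - (g 0 + m * s)) has_real_derivative (0 - m)) (at 0 within {0..1})"
    using g[of 0] \<open>g' 0 = 0\<close> by (auto intro!: derivative_eq_intros)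
  from has_real_derivative_pos_inc_right[OF this] m
  obtain d' where d': "0 < d'" "\<And>s. 0 < s \<Longrightarrow> s \<in> {0..1} \<Longrightarrow> s < d' \<Longrightarrow> 0 < g s - (g 0 + m * s)"
    by auto
  define s where "s = min (d' / 2) t"
  have s: "0 < s" "s \<le> t" "s < d'" using d' t by (auto simp: s_def)
  have "g ((1 - s / t) *\<^sub>R 0 + (s / t) *\<^sub>R t) \<le> (1 - s / t) * g 0 + (s / t) * g t"
    using s t by (intro convex_onD[OF conv]) auto
  then have "g s \<le> g 0 + m * s"
    using t by (simp add: m_def field_simps)
  then show False using d'(2)[of s] s t by auto
qed

section \<open>The Euclidean Hessian at a critical point\<close>

theorem proposition3p1:
  fixes f :: "real^'n \<Rightarrow> real"
  assumes "smooth f"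
    and "\<exists>nabla. torsion_free_connection nabla \<and> g_convex nabla f"
  shows "\<forall>x. critical_point f x \<longrightarrow> pos_semidef (hessian_matrix f x)"
proof (intro allI impI)
  fix p assume crit: "critical_point f p"
  obtain nabla where nabla: "torsion_free_connection nabla" "g_convex nabla f" using assms by blast
  have C2: "Ck (Suc (Suc 0)) f" using assms by (simp add: smooth_def)
  have df: "(f has_derivative frechet_derivative f (at y)) (at y)" for y
    using C2 by (simp add: frechet_derivative_works)
  have dpf: "(partial_deriv j f has_derivative frechet_derivative (partial_deriv j f) (at y)) (at y)" for j y
    using C2 by (simp add: frechet_derivative_works partial_deriv_def[abs_def])
  have expand: "D w = (\<Sum>i\<in>UNIV. w $ i * D (axis i 1))" if "linear D"
    for D :: "real^'n \<Rightarrow> real" and w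
  proof -
    have "D w = D (\<Sum>i\<in>UNIV. w $ i *\<^sub>R axis i 1)"
      by (simp add: basis_expansion flip: scalar_mult_eq_scaleR)
    also have "\<dots> = (\<Sum>i\<in>UNIV. w $ i * D (axis i 1))"
      using that by (simp add: linear_sum linear_cmul)
    finally show ?thesis .
  qed
  have crit0: "partial_deriv j f p = 0" for j
    using crit frechet_derivative_at[of f "\<lambda>_. 0" p]
    by (simp add: critical_point_def partial_deriv_def fun_eq_iff)
  show "pos_semidef (hessian_matrix f p)"
    unfolding pos_semidef_def
  proof (intro conjI allI)
    show "transpose (hessian_matrix f p) = hessian_matrix f p"
      using frechet_derivative_commute[OF C2]
      by (simp add: transpose_def hessian_matrix_def vec_eq_iff partial_deriv_def[abs_def])
    fix v :: "real^'n"
    obtain e \<gamma> where e: "0 < e" and geo: "geodesic nabla \<gamma>" and \<gamma>0: "\<gamma> 0 = p"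
      and v: "(\<gamma> has_vector_derivative e *\<^sub>R v) (at 0 within {0..1})"
      using geodesic_exists[OF nabla(1)] by metis
    obtain \<gamma>' \<gamma>'' where \<gamma>': "\<And>t. t \<in> {0..1} \<Longrightarrow> (\<gamma> has_vector_derivative \<gamma>' t) (at t within {0..1})"
      and \<gamma>'': "\<And>t. t \<in> {0..1} \<Longrightarrow> (\<gamma>' has_vector_derivative \<gamma>'' t) (at t within {0..1})"
      using geo unfolding geodesic_def by blast
    \<comment> \<open>The velocity unpacked from \<open>geodesic\<close> is a fresh witness;
      uniqueness of the one-sided derivative identifies it with the prescribed one.\<close>
    have w: "\<gamma>' 0 = e *\<^sub>R v"
      using vector_derivative_unique_within[OF _ \<gamma>'[of 0] v]
      by (simp add: trivial_limit_within islimpt_Icc)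
    have along: "((\<lambda>s. g (\<gamma> s)) has_real_derivative (\<Sum>j\<in>UNIV. \<gamma>' t $ j * partial_deriv j g (\<gamma> t))) (at t within {0..1})"
      if t: "t \<in> {0..1}" and dg: "(g has_derivative frechet_derivative g (at (\<gamma> t))) (at (\<gamma> t))"
      for g :: "real^'n \<Rightarrow> real" and t
    proof -
      have lin: "linear (frechet_derivative g (at (\<gamma> t)))"
        using dg by (rule has_derivative_linear)
      have "((\<lambda>s. g (\<gamma> s)) has_derivative (\<lambda>u. frechet_derivative g (at (\<gamma> t)) (u *\<^sub>R \<gamma>' t))) (at t within {0..1})"
        using has_derivative_compose[OF \<gamma>'[OF t, unfolded has_vector_derivative_def] dg] .
      then show ?thesis
        unfolding has_field_derivative_def linear_cmul[OF lin] expand[OF lin, of "\<gamma>' t"]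
        by (simp add: partial_deriv_def mult.commute[of _ "sum _ _"])
    qed
    define g' where "g' t = (\<Sum>j\<in>UNIV. \<gamma>' t $ j * partial_deriv j f (\<gamma> t))" for t
    \<comment> \<open>This is the second derivative of \<open>f \<circ> \<gamma>\<close> at 0
      without the terms containing \<open>\<gamma>'' 0\<close>. Those are multiplied by first
      partial derivatives of \<open>f\<close> at \<open>p\<close>, which vanish, so the Christoffel
      symbols leave no trace.\<close>
    define c where "c = (\<Sum>j\<in>UNIV. \<gamma>' 0 $ j * (\<Sum>i\<in>UNIV. \<gamma>' 0 $ i * partial_deriv i (partial_deriv j f) p))"
    have "0 \<le> c"
    proof (rule convex_on_second_derivative_nonneg)
      show "convex_on {0..1} (f \<circ> \<gamma>)" using nabla geo by (simp add: g_convex_def)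
      show "((f \<circ> \<gamma>) has_real_derivative g' t) (at t within {0..1})" if "t \<in> {0..1}" for t
        using along[OF that df] by (simp add: g'_def o_def)
      show "g' 0 = 0" by (simp add: g'_def \<gamma>0 crit0)
      have comp: "((\<lambda>s. \<gamma>' s $ j) has_real_derivative \<gamma>'' 0 $ j) (at 0 within {0..1})" for j
        using bounded_linear.has_vector_derivative[OF bounded_linear_vec_nth \<gamma>''[of 0]]
        by (simp add: has_real_derivative_iff_has_vector_derivative)
      show "(g' has_real_derivative c) (at 0 within {0..1})"
        unfolding g'_def c_def
        using along[OF _ dpf, of 0]
        by (auto intro!: derivative_eq_intros comp sum.cong simp: \<gamma>0 crit0)
    qed
    \<comment> \<open>Both velocity factors contribute \<open>e\<close>. After the sums are
      exchanged to match the row-first expansion of the matrix product, the positive factor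
      \<open>e\<^sup>2\<close> can be cancelled.\<close>
    also have "c = (\<Sum>j\<in>UNIV. \<Sum>i\<in>UNIV. e\<^sup>2 * (v $ i * (partial_deriv i (partial_deriv j f) p * v $ j)))"
      by (simp add: c_def w sum_distrib_left power2_eq_square ac_simps)
    also have "\<dots> = (\<Sum>i\<in>UNIV. \<Sum>j\<in>UNIV. e\<^sup>2 * (v $ i * (partial_deriv i (partial_deriv j f) p * v $ j)))"
      by (rule sum.swap)
    also have "\<dots> = e\<^sup>2 * (v \<bullet> (hessian_matrix f p *v v))"
      by (simp add: inner_vec_def matrix_vector_mult_def hessian_matrix_def sum_distrib_left)
    finally show "0 \<le> v \<bullet> (hessian_matrix f p *v v)"
      using e by (simp add: zero_le_mult_iff)
  qed
qed

end
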